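(* Let $n>2$ and let $\mathbf{w}=(w_1,\dots,w_n)$ be a vector with positive coordinates which satisfies the $k$th Fishburn condition. Then there exists a simple game on $n+k$ players which is $(k-1)$-trade robust but not $k$-trade robust.
   Context: For $X,Y\subseteq[n]$ let $\mathbf{v}_{X,Y}=\chi(X)-\chi(Y)\in\{-1,0,1\}^n$, where $\chi$ denotes the characteristic vector, and $w(X)=\sum_{i\in X}w_i$. A vector $\mathbf{w}$ with non-negative coordinates satisfies the $k$th Fishburn condition if there exist distinct vectors $\mathbf{v}_i=\mathbf{v}_{X_i,Y_i}$, $i=1,\dots,k$, with $X_i\cap Y_i=\emptyset$, such that: (1) $w(X_i)=w(Y_i)$ (i.e. $\mathbf{v}_i\cdot\mathbf{w}=0$) for all $i$; (2) there are no other such relations, i.e. whenever $X,Y\subseteq[n]$ are disjoint, not both empty, with $w(X)=w(Y)$, then $\{X,Y\}=\{X_i,Y_i\}$ for some $i$; (3) $\sum_{i=1}^k\mathbf{v}_i=\mathbf{0}$; (4) no proper subset of $\{\mathbf{v}_1,\dots,\mathbf{v}_k\}$ is linearly dependent. A simple game is a pair $(P,W)$, $P$ a finite player set, $W\subseteq 2^P$ (winning coalitions) closed under supersets within $P$, $W\ne\emptyset$, $W\ne 2^P$; other coalitions are losing. A trading transform is $(X_1,\dots,X_j;Y_1,\dots,Y_j)$ with every player in equally many $X_i$'s and $Y_i$'s; a game is $k$-trade robust if no trading transform with $j\le k$ has all $X_i$ winning and all $Y_i$ losing.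
   Formalization: Assumes k ≥ 2, and n ≥ 6 when k = 3: the claim fails for k = 1 (e.g. w = (1,2,4) with the zero relation) and for k = 3, n = 3, 4, 5 (e.g. w = (1,1,1)), since 2-trade robust games on at most 8 players are weighted. *)

theory Defs
  imports "HOL-Analysis.Analysis"
begin

(* The index set [n] is the universe of a finite type 'n, with n = CARD('n). *)

definition char_vec :: "'n::finite set \<Rightarrow> real ^ 'n" where
  "char_vec X = (\<chi> i. if i \<in> X then 1 else 0)"

definition diff_vec :: "'n::finite set \<Rightarrow> 'n set \<Rightarrow> real ^ 'n" where
  "diff_vec X Y = char_vec X - char_vec Y"

definition weight :: "real ^ 'n \<Rightarrow> 'n::finite set \<Rightarrow> real" where
  "weight w X = (\<Sum>i\<in>X. w $ i)"

(* The k vectors are pairwise distinct (injectivity), so the sum over indices is the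
   sum over the set of vectors, and proper subsets of that set are meant literally.
   A pair (X i, Y i) = ({}, {}) is not excluded here; for k \<ge> 2 it is ruled out by the
   last clause, whereas for k = 1 it is the only possibility. *)
definition fishburn_condition :: "nat \<Rightarrow> real ^ 'n::finite \<Rightarrow> bool" where
  "fishburn_condition k w \<longleftrightarrow>
     (\<forall>i. 0 \<le> w $ i) \<and>
     (\<exists>X Y :: nat \<Rightarrow> 'n set.
        inj_on (\<lambda>i. diff_vec (X i) (Y i)) {1..k} \<and>
        (\<forall>i\<in>{1..k}. X i \<inter> Y i = {}) \<and>
        (\<forall>i\<in>{1..k}. weight w (X i) = weight w (Y i)) \<and>
        (\<forall>A B. A \<inter> B = {} \<and> \<not> (A = {} \<and> B = {}) \<and> weight w A = weight w B \<longrightarrow>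
           (\<exists>i\<in>{1..k}. {A, B} = {X i, Y i})) \<and>
        (\<Sum>i=1..k. diff_vec (X i) (Y i)) = 0 \<and>
        (\<forall>S. S \<subset> (\<lambda>i. diff_vec (X i) (Y i)) ` {1..k} \<longrightarrow> \<not> dependent S))"

definition simple_game :: "'p set \<Rightarrow> 'p set set \<Rightarrow> bool" where
  "simple_game P W \<longleftrightarrow>
     finite P \<and> W \<subseteq> Pow P \<and>
     (\<forall>A B. A \<in> W \<and> A \<subseteq> B \<and> B \<subseteq> P \<longrightarrow> B \<in> W) \<and>
     W \<noteq> {} \<and> W \<noteq> Pow P"

definition trading_transform ::
  "'p set \<Rightarrow> nat \<Rightarrow> (nat \<Rightarrow> 'p set) \<Rightarrow> (nat \<Rightarrow> 'p set) \<Rightarrow> bool" where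
  "trading_transform P j X Y \<longleftrightarrow>
     (\<forall>i\<in>{1..j}. X i \<subseteq> P \<and> Y i \<subseteq> P) \<and>
     (\<forall>p\<in>P. card {i \<in> {1..j}. p \<in> X i} = card {i \<in> {1..j}. p \<in> Y i})"

(* Trading transforms have length j \<ge> 1: the empty one would satisfy the
   winning and losing requirements vacuously. *)
definition trade_robust :: "nat \<Rightarrow> 'p set \<Rightarrow> 'p set set \<Rightarrow> bool" where
  "trade_robust k P W \<longleftrightarrow>
     \<not> (\<exists>j X Y. 1 \<le> j \<and> j \<le> k \<and> trading_transform P j X Y \<and>
           (\<forall>i\<in>{1..j}. X i \<in> W) \<and> (\<forall>i\<in>{1..j}. Y i \<in> Pow P - W))"

end

theory Submission
  imports Defs
begin

text \<open>
  Add to the \<open>n\<close> old players one heavy player for each relation \<open>w(X\<^sub>i) = w(Y\<^sub>i)\<close>, whose weight is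
  a huge threshold \<open>q\<close> minus \<open>w(X\<^sub>i)\<close>.  A coalition of weight exactly \<open>q\<close> then contains exactly one
  heavy player, and for \<open>k \<noteq> 3\<close> the Fishburn condition leaves only \<open>X\<^sub>i\<close> and \<open>Y\<^sub>i\<close>, each with the
  \<open>i\<close>-th heavy player.  Let the former win and the latter lose.  As the weights on both sides
  of a trading transform agree, a transform from winning to losing coalitions uses only these
  ties, so it is a nonnegative integral dependence of the \<open>v\<^sub>i\<close>, and all of these are multiples of
  \<open>v\<^sub>1 + \<dots> + v\<^sub>k = 0\<close>, which takes \<open>k\<close> coalitions.

  For \<open>k = 3\<close> there may be further ties: for \<open>w = (1,1,1)\<close> the three relations give nine tied
  coalitions, and no way of breaking the ties works.  Here a game not depending on \<open>w\<close> is used: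
  a semimagic square whose rows win and whose columns lose, extended by dummy players.
\<close>

section \<open>Breaking ties in a weighted game\<close>

text \<open>Double counting: a player \<open>p\<close> contributes \<open>f p\<close> once for each
  coalition containing it, and a trading transform balances these multiplicities.\<close>

lemma trading_transform_sum_eq:
  fixes f :: "'p \<Rightarrow> real"
  assumes "finite P" "trading_transform P j X Y"
  shows "(\<Sum>i=1..j. sum f (X i)) = (\<Sum>i=1..j. sum f (Y i))"
proof -
  have count: "(\<Sum>i=1..j. sum f (Z i)) = (\<Sum>p\<in>P. real (card {i\<in>{1..j}. p \<in> Z i}) * f p)"
    if "\<forall>i\<in>{1..j}. Z i \<subseteq> P" for Z
  proof -
    have "sum f (Z i) = (\<Sum>p\<in>P. if p \<in> Z i then f p else 0)" if "i \<in> {1..j}" for i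
      using \<open>\<forall>i\<in>{1..j}. Z i \<subseteq> P\<close> that
      by (simp add: sum.inter_restrict [OF assms(1), symmetric] inf_absorb2)
    then have "(\<Sum>i=1..j. sum f (Z i)) = (\<Sum>i=1..j. \<Sum>p\<in>P. if p \<in> Z i then f p else 0)"
      by (rule sum.cong [OF refl])
    also have "\<dots> = (\<Sum>p\<in>P. \<Sum>i=1..j. if p \<in> Z i then f p else 0)"
      by (rule sum.swap)
    also have "\<dots> = (\<Sum>p\<in>P. real (card {i\<in>{1..j}. p \<in> Z i}) * f p)"
      by (intro sum.cong refl) (simp add: sum.inter_filter [symmetric])
    finally show ?thesis .
  qed
  have sub: "\<forall>i\<in>{1..j}. X i \<subseteq> P" "\<forall>i\<in>{1..j}. Y i \<subseteq> P"
    and "\<forall>p\<in>P. card {i\<in>{1..j}. p \<in> X i} = card {i\<in>{1..j}. p \<in> Y i}"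
    using assms(2) unfolding trading_transform_def by blast+
  then show ?thesis
    unfolding count [OF sub(1)] count [OF sub(2)] by (intro sum.cong refl) (simp only:)
qed

text \<open>A coalition wins if it is heavier than \<open>q\<close> or is one of the
  \<open>T i\<close>. This reduces both constructions to listing the coalitions of weight
  \<open>q\<close> and checking \<open>short\<close>, which concerns these ties alone.\<close>

lemma tie_breaking_game:
  fixes f :: "'p \<Rightarrow> real" and T U :: "nat \<Rightarrow> 'p set"
  assumes fin: "finite P"
    and pos: "\<And>p. p \<in> P \<Longrightarrow> 0 < f p"
    and q: "0 < q"
    and k: "2 \<le> k"
    and weight: "\<And>i. i \<in> {1..k} \<Longrightarrow> sum f (T i) = q" "\<And>i. i \<in> {1..k} \<Longrightarrow> sum f (U i) = q"
    and ties: "\<And>S. S \<subseteq> P \<Longrightarrow> sum f S = q \<Longrightarrow> S \<in> T ` {1..k} \<or> S \<in> U ` {1..k}"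
    and trade: "trading_transform P k T U"
    and short: "\<And>j X Y. 1 \<le> j \<Longrightarrow> j < k \<Longrightarrow> trading_transform P j X Y
      \<Longrightarrow> X ` {1..j} \<subseteq> T ` {1..k} \<Longrightarrow> Y ` {1..j} \<subseteq> U ` {1..k} \<Longrightarrow> False"
  shows "\<exists>W. simple_game P W \<and> trade_robust (k - 1) P W \<and> \<not> trade_robust k P W"
proof -
  define W where "W = {S. S \<subseteq> P \<and> (q < sum f S \<or> S \<in> T ` {1..k})}"
  have sub: "T i \<subseteq> P" "U i \<subseteq> P" if "i \<in> {1..k}" for i
    using trade that unfolding trading_transform_def by auto
  have TW: "T i \<in> W" if "i \<in> {1..k}" for i
    using sub that by (auto simp: W_def)
  have W_ge: "q \<le> sum f S" if "S \<in> W" for S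
    using that weight by (force simp: W_def)
  have not_W_le: "sum f S \<le> q" if "S \<in> Pow P - W" for S
    using that by (auto simp: W_def)
  have UW: "U i \<in> Pow P - W" if i: "i \<in> {1..k}" for i
  proof -
    \<comment> \<open>A coalition in both families could be traded for itself, a transform of length
      1 < \<open>k\<close> that \<open>short\<close> forbids.\<close>
    have "U i \<noteq> T l" if l: "l \<in> {1..k}" for l
    proof
      assume eq: "U i = T l"
      have "trading_transform P 1 (\<lambda>_. T l) (\<lambda>_. U i)"
        using sub i l eq by (auto simp: trading_transform_def)
      then show False
        using short[of 1 "\<lambda>_. T l" "\<lambda>_. U i"] k i l by auto
    qed
    then have "U i \<notin> T ` {1..k}"
      by blast
    then show ?thesis
      using sub(2)[OF i] weight(2)[OF i] by (simp add: W_def)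
  qed
  have "W \<subseteq> Pow P"
    by (auto simp: W_def)
  \<comment> \<open>Weights are positive, so a proper superset of a winning coalition is strictly
    heavier than \<open>q\<close> and wins however ties are broken.\<close>
  moreover have "B \<in> W" if A: "A \<in> W" and AB: "A \<subseteq> B" "B \<subseteq> P" for A B
  proof (cases "A = B")
    case False
    then obtain b where "b \<in> B - A"
      using AB by blast
    then have "sum f A < sum f B"
      using AB fin pos by (intro sum_strict_mono2[of B A b]) (auto intro: finite_subset less_imp_le)
    then show ?thesis
      using W_ge[OF A] AB by (auto simp: W_def)
  qed (use A in simp)
  moreover have "{} \<notin> W"
    using W_ge[of "{}"] q by auto
  then have "W \<noteq> Pow P"
    by blast
  moreover have "W \<noteq> {}"
    using TW[of 1] k by auto
  ultimately have "simple_game P W"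
    unfolding simple_game_def using fin by blast
  moreover have "trade_robust (k - 1) P W"
    unfolding trade_robust_def
  proof clarify
    fix j X Y
    assume j: "1 \<le> j" "j \<le> k - 1" and tt: "trading_transform P j X Y"
      and X: "\<forall>i\<in>{1..j}. X i \<in> W" and Y: "\<forall>i\<in>{1..j}. Y i \<in> Pow P - W"
    \<comment> \<open>Excesses of winners over \<open>q\<close> and deficits of losers are
      nonnegative and add up to 0, so each of them vanishes.\<close>
    have "(\<Sum>i=1..j. sum f (X i) - q) + (\<Sum>i=1..j. q - sum f (Y i)) = 0"
      using trading_transform_sum_eq[OF fin tt, of f] by (simp add: sum_subtractf)
    moreover have nonneg: "\<And>i. i \<in> {1..j} \<Longrightarrow> 0 \<le> sum f (X i) - q" "\<And>i. i \<in> {1..j} \<Longrightarrow> 0 \<le> q - sum f (Y i)"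
      using X Y W_ge not_W_le by auto
    moreover have "0 \<le> (\<Sum>i=1..j. sum f (X i) - q)" "0 \<le> (\<Sum>i=1..j. q - sum f (Y i))"
      by (rule sum_nonneg, erule nonneg)+
    ultimately have sum0: "(\<Sum>i=1..j. sum f (X i) - q) = 0" "(\<Sum>i=1..j. q - sum f (Y i)) = 0"
      by linarith+
    have "sum f (X i) - q = 0" if "i \<in> {1..j}" for i
      by (rule sum_nonneg_0[where s = "{1..j}" and f = "\<lambda>i. sum f (X i) - q"]) (use sum0 nonneg that in auto)
    moreover have "q - sum f (Y i) = 0" if "i \<in> {1..j}" for i
      by (rule sum_nonneg_0[where s = "{1..j}" and f = "\<lambda>i. q - sum f (Y i)"]) (use sum0 nonneg that in auto)
    ultimately have eq: "\<forall>i\<in>{1..j}. sum f (X i) = q" "\<forall>i\<in>{1..j}. sum f (Y i) = q"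
      by simp_all
    have "X ` {1..j} \<subseteq> T ` {1..k}"
      using X eq(1) by (auto simp: W_def)
    moreover have "Y ` {1..j} \<subseteq> U ` {1..k}"
    proof clarify
      fix i assume i: "i \<in> {1..j}"
      then have "Y i \<subseteq> P" "Y i \<notin> W" "sum f (Y i) = q"
        using Y eq(2) by simp_all
      moreover from this have "Y i \<notin> T ` {1..k}"
        by (simp add: W_def)
      ultimately show "Y i \<in> U ` {1..k}"
        using ties[of "Y i"] by simp
    qed
    moreover have "j < k"
      using j k by simp
    ultimately show False
      using short[OF j(1) _ tt] by simp
  qed
  moreover have "\<not> trade_robust k P W"
  proof -
    have "1 \<le> k"
      using k by simp
    then show ?thesis
      unfolding trade_robust_def using trade TW UW by blast
  qed
  ultimately show ?thesis
    by blast
qed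

section \<open>Renaming players and adding dummies\<close>

text \<open>A coalition of \<open>Q\<close> wins if its preimage under a numbering \<open>h\<close>
  of \<open>P\<close> wins, so the players outside the image of \<open>P\<close> are dummies.
  Transforms pull back along \<open>h\<close>, which keeps robustness, and push forward, which keeps
  its failure.\<close>

lemma game_on_nat:
  fixes P :: "'p set"
  assumes game: "simple_game P W"
    and robust: "trade_robust l P W"
    and not_robust: "\<not> trade_robust k P W"
    and m: "card P \<le> m"
  shows "\<exists>(Q :: nat set) V. simple_game Q V \<and> card Q = m \<and>
           trade_robust l Q V \<and> \<not> trade_robust k Q V"
proof -
  have fin: "finite P" and WP: "W \<subseteq> Pow P"
    and up: "\<And>A B. A \<in> W \<Longrightarrow> A \<subseteq> B \<Longrightarrow> B \<subseteq> P \<Longrightarrow> B \<in> W"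
    and ne: "W \<noteq> {}" "W \<noteq> Pow P"
    using game unfolding simple_game_def by blast+
  obtain h where h: "bij_betw h P {0..<card P}"
    using ex_bij_betw_finite_nat[OF fin] by blast
  then have inj: "inj_on h P"
    by (rule bij_betw_imp_inj_on)
  define Q where "Q = {..<m}"
  have hQ: "h p \<in> Q" if "p \<in> P" for p
    using bij_betwE[OF h] that m by (force simp: Q_def)
  define pull where "pull S = {p\<in>P. h p \<in> S}" for S
  define V where "V = {S. S \<subseteq> Q \<and> pull S \<in> W}"
  have pull_sub: "pull S \<subseteq> P" for S
    by (auto simp: pull_def)
  have pull_image: "pull (h ` A) = A" if "A \<subseteq> P" for A
    using that inj by (auto simp: pull_def inj_on_def)
  have V_image: "h ` A \<in> V \<longleftrightarrow> A \<in> W" "h ` A \<subseteq> Q" if "A \<subseteq> P" for A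
    using that hQ by (auto simp: V_def pull_image)
  have "B \<in> V" if "A \<in> V" "A \<subseteq> B" "B \<subseteq> Q" for A B
    using up[of "pull A" "pull B"] that by (auto simp: V_def pull_def)
  moreover have "V \<noteq> {}"
    using ne(1) WP V_image(1) by blast
  moreover have "V \<noteq> Pow Q"
    using ne(2) WP V_image by blast
  ultimately have "simple_game Q V"
    unfolding simple_game_def by (auto simp: Q_def V_def)
  moreover have "trade_robust l Q V"
    unfolding trade_robust_def
  proof clarify
    fix j X Y
    assume j: "1 \<le> j" "j \<le> l" and tt: "trading_transform Q j X Y"
      and X: "\<forall>i\<in>{1..j}. X i \<in> V" and Y: "\<forall>i\<in>{1..j}. Y i \<in> Pow Q - V"
    have "trading_transform P j (\<lambda>i. pull (X i)) (\<lambda>i. pull (Y i))"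
      using tt hQ by (auto simp: trading_transform_def pull_def)
    moreover have "\<forall>i\<in>{1..j}. pull (X i) \<in> W" "\<forall>i\<in>{1..j}. pull (Y i) \<in> Pow P - W"
      using X Y pull_sub by (auto simp: V_def)
    ultimately show False
      using robust j unfolding trade_robust_def by blast
  qed
  moreover have "\<not> trade_robust k Q V"
  proof -
    obtain j X Y where j: "1 \<le> j" "j \<le> k" and tt: "trading_transform P j X Y"
      and X: "\<forall>i\<in>{1..j}. X i \<in> W" and Y: "\<forall>i\<in>{1..j}. Y i \<in> Pow P - W"
      using not_robust unfolding trade_robust_def by blast
    have sub: "\<forall>i\<in>{1..j}. X i \<subseteq> P \<and> Y i \<subseteq> P"
      and card: "\<And>p. p \<in> P \<Longrightarrow> card {i\<in>{1..j}. p \<in> X i} = card {i\<in>{1..j}. p \<in> Y i}"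
      using tt by (auto simp: trading_transform_def)
    have "card {i\<in>{1..j}. x \<in> h ` X i} = card {i\<in>{1..j}. x \<in> h ` Y i}" for x
    proof (cases "x \<in> h ` P")
      case True
      then obtain p where p: "p \<in> P" "x = h p"
        by blast
      have mem: "h p \<in> h ` A \<longleftrightarrow> p \<in> A" if "A \<subseteq> P" for A
        using inj_on_image_mem_iff[OF inj p(1) that] .
      have "x \<in> h ` X i \<longleftrightarrow> p \<in> X i" "x \<in> h ` Y i \<longleftrightarrow> p \<in> Y i" if "i \<in> {1..j}" for i
        using sub mem p(2) that by simp_all
      then have "{i\<in>{1..j}. x \<in> h ` X i} = {i\<in>{1..j}. p \<in> X i}"
        "{i\<in>{1..j}. x \<in> h ` Y i} = {i\<in>{1..j}. p \<in> Y i}"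
        by (auto simp del: image_iff)
      then show ?thesis
        using card[OF p(1)] by simp
    next
      case False
      then have "{i\<in>{1..j}. x \<in> h ` X i} = {}" "{i\<in>{1..j}. x \<in> h ` Y i} = {}"
        using sub by blast+
      then show ?thesis
        by (simp only:)
    qed
    then have "trading_transform Q j (\<lambda>i. h ` X i) (\<lambda>i. h ` Y i)"
      using sub hQ unfolding trading_transform_def by blast
    moreover have "\<forall>i\<in>{1..j}. h ` X i \<in> V" "\<forall>i\<in>{1..j}. h ` Y i \<in> Pow Q - V"
      using X Y sub V_image by auto
    ultimately show ?thesis
      using j unfolding trade_robust_def by blast
  qed
  ultimately show ?thesis
    by (intro exI[of _ Q] exI[of _ V]) (simp add: Q_def)
qed

section \<open>The heavy players\<close>

text \<open>Common elements cancel. Together with \<open>weight_eq_iff_weight_Diff_eq\<close> this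
  extends the Fishburn condition from disjoint pairs to arbitrary sets of equal weight.\<close>

lemma diff_vec_Diff: "diff_vec (A - B) (B - A) = diff_vec A B"
  by (auto simp: diff_vec_def char_vec_def vec_eq_iff)

lemma diff_vec_commute: "diff_vec B A = - diff_vec A B"
  by (simp add: diff_vec_def)

lemma weight_eq_iff_weight_Diff_eq:
  "weight w A = weight w B \<longleftrightarrow> weight w (A - B) = weight w (B - A)"
proof -
  have "weight w A = weight w (A - B) + weight w (A \<inter> B)"
    "weight w B = weight w (B - A) + weight w (A \<inter> B)"
    unfolding weight_def by (simp_all add: sum.Int_Diff[of A _ B] sum.Int_Diff[of B _ A] Int_commute)
  then show ?thesis
    by linarith
qed

lemma fishburn_game:
  fixes w :: "real ^ 'n::finite"
  assumes w_pos: "\<And>i. 0 < w $ i"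
    and fishburn: "fishburn_condition k w"
    and k_ge_2: "2 \<le> k" and k_neq_3: "k \<noteq> 3"
  shows "\<exists>(P :: ('n + nat) set) W. simple_game P W \<and> card P = CARD('n) + k \<and>
           trade_robust (k - 1) P W \<and> \<not> trade_robust k P W"
proof -
  obtain X Y :: "nat \<Rightarrow> 'n set" where
    inj: "inj_on (\<lambda>i. diff_vec (X i) (Y i)) {1..k}"
    and eq': "\<forall>i\<in>{1..k}. weight w (X i) = weight w (Y i)"
    and only': "\<forall>A B. A \<inter> B = {} \<and> \<not> (A = {} \<and> B = {}) \<and> weight w A = weight w B \<longrightarrow>
      (\<exists>i\<in>{1..k}. {A, B} = {X i, Y i})"
    and sum0: "(\<Sum>i=1..k. diff_vec (X i) (Y i)) = 0"
    and indep': "\<forall>S. S \<subset> (\<lambda>i. diff_vec (X i) (Y i)) ` {1..k} \<longrightarrow> \<not> dependent S"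
    using fishburn unfolding fishburn_condition_def by (elim exE conjE)
  note eq = eq' [rule_format]
    and only = only' [rule_format, OF conjI, OF _ conjI]
    and indep = indep' [rule_format]
  define v where "v i = diff_vec (X i) (Y i)" for i

  \<comment> \<open>Linear dependences of the vectors \<open>v i\<close>\<close>
  have coeff_eq: "c i = c 1" if c: "(\<Sum>i=1..k. c i *\<^sub>R v i) = 0" and i: "i \<in> {1..k}" for c i
  proof (cases "i = 1")
    case False
    have injv: "inj_on v {1..k}"
      using inj by (simp add: v_def[abs_def])
    then have injv2: "inj_on v {2..k}"
      by (rule inj_on_subset) auto
    have split: "{1..k} = insert 1 {2..k}"
      using k_ge_2 by auto
    have "v 1 \<notin> v ` {2..k}"
      using injv by (force simp: inj_on_def)
    then have "v ` {2..k} \<subset> v ` {1..k}"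
      unfolding split by auto
    then have ind: "independent (v ` {2..k})"
      using indep by (simp add: v_def[abs_def])
    \<comment> \<open>Subtracting \<open>c 1\<close> times the relation \<open>sum0\<close>
      eliminates \<open>v 1\<close> and leaves only the independent vectors.\<close>
    have "(\<Sum>i=1..k. (c i - c 1) *\<^sub>R v i) = 0"
      using c sum0 by (simp add: scaleR_diff_left sum_subtractf scaleR_sum_right [symmetric] v_def)
    then have "(\<Sum>i=2..k. (c i - c 1) *\<^sub>R v i) = 0"
      unfolding split by simp
    \<comment> \<open>\<open>independentD\<close> wants coefficients indexed by vectors, hence the
      passage through the inverse of \<open>v\<close>.\<close>
    then have "(\<Sum>x\<in>v ` {2..k}. (c (the_inv_into {2..k} v x) - c 1) *\<^sub>R x) = 0"
      by (simp add: sum.reindex[OF injv2] the_inv_into_f_f[OF injv2])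
    then have "c (the_inv_into {2..k} v (v i)) - c 1 = 0"
      using independentD[OF ind, of "v ` {2..k}" "\<lambda>x. c (the_inv_into {2..k} v x) - c 1" "v i"] i False
      by auto
    then show ?thesis
      using i False by (simp add: the_inv_into_f_f[OF injv2])
  qed simp

  \<comment> \<open>The unordered pair in \<open>only\<close> leaves the sign of \<open>v l\<close>
    open. Signs are integers with a view to divisibility by \<open>k\<close>.\<close>
  have relation: "\<exists>l\<in>{1..k}. \<exists>\<epsilon>\<in>{1, - 1 :: int}. diff_vec A B = of_int \<epsilon> *\<^sub>R v l"
    if "weight w A = weight w B" "A \<noteq> B" for A B
  proof -
    have "weight w (A - B) = weight w (B - A)"
      using that(1) weight_eq_iff_weight_Diff_eq by blast
    moreover have "\<not> (A - B = {} \<and> B - A = {})"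
      using that(2) by blast
    ultimately obtain l where l: "l \<in> {1..k}" "{A - B, B - A} = {X l, Y l}"
      using only[of "A - B" "B - A"] by blast
    then have "diff_vec A B = v l \<or> diff_vec A B = - v l"
      unfolding diff_vec_Diff[of A B, symmetric] v_def diff_vec_commute[of "Y l" "X l", symmetric]
      by (auto simp: doubleton_eq_iff)
    then show ?thesis
      using l(1) by force
  qed

  text \<open>
    If \<open>\<chi>(A) - \<chi>(X\<^sub>i) = \<plusminus>v\<^sub>j\<close> and \<open>\<chi>(A) - \<chi>(Y\<^sub>i) = \<plusminus>v\<^sub>l\<close>, then \<open>\<plusminus>v\<^sub>l \<mp> v\<^sub>j - v\<^sub>i = 0\<close>.  As all
    coefficients are the same integer, \<open>k\<close> divides their sum, which is \<open>\<plusminus>1\<close> or \<open>\<plusminus>3\<close>.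
  \<close>
  have tie: "A = X i \<or> A = Y i" if i: "i \<in> {1..k}" and A: "weight w A = weight w (X i)" for i A
  proof (rule ccontr)
    assume neg: "\<not> (A = X i \<or> A = Y i)"
    obtain j \<epsilon> where j: "j \<in> {1..k}" "\<epsilon> \<in> {1, -1 :: int}" "diff_vec A (X i) = of_int \<epsilon> *\<^sub>R v j"
      using relation[of A "X i"] A neg by blast
    have "weight w A = weight w (Y i)" "A \<noteq> Y i"
      using A eq[OF i] neg by auto
    then obtain l \<delta> where l: "l \<in> {1..k}" "\<delta> \<in> {1, -1 :: int}" "diff_vec A (Y i) = of_int \<delta> *\<^sub>R v l"
      using relation[of A "Y i"] by blast
    \<comment> \<open>The indices \<open>i\<close>, \<open>j\<close>, \<open>l\<close> may coincide;
      the contributions then add, and the total stays the same.\<close>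
    define c :: "nat \<Rightarrow> int" where
      "c m = (if m = l then \<delta> else 0) - (if m = j then \<epsilon> else 0) - (if m = i then 1 else 0)" for m
    have "(\<Sum>m=1..k. of_int (c m) *\<^sub>R v m)
        = (\<Sum>m=1..k. (if m = l then of_int \<delta> *\<^sub>R v m else 0) - (if m = j then of_int \<epsilon> *\<^sub>R v m else 0)
            - (if m = i then v m else 0))"
      by (intro sum.cong refl) (auto simp: c_def scaleR_diff_left)
    also have "\<dots> = of_int \<delta> *\<^sub>R v l - of_int \<epsilon> *\<^sub>R v j - v i"
      using i j(1) l(1) by (simp add: sum_subtractf)
    also have "\<dots> = 0"
      unfolding j(3)[symmetric] l(3)[symmetric] by (simp add: v_def diff_vec_def)
    finally have "c m = c 1" if "m \<in> {1..k}" for m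
      using coeff_eq[of "\<lambda>m. of_int (c m)" m] that by simp
    then have "(\<Sum>m=1..k. c m) = (\<Sum>m=1..k. c 1)"
      by (rule sum.cong [OF refl])
    moreover have "(\<Sum>m=1..k. c m) = \<delta> - \<epsilon> - 1"
      using i j(1) l(1) by (simp add: c_def sum_subtractf)
    ultimately have "\<delta> - \<epsilon> - 1 = int k * c 1"
      by simp
    then have "int k dvd \<delta> - \<epsilon> - 1"
      by (rule dvdI)
    then have "int k dvd 1 \<or> int k dvd 3"
      using j(2) l(2) by auto
    then have "k dvd 1 \<or> k dvd 3"
      using int_dvd_int_iff[of k 1] int_dvd_int_iff[of k 3] by simp
    moreover have "k \<le> 3" if "k dvd 3"
      using that by (auto dest: dvd_imp_le)
    moreover have "\<not> 2 dvd (3::nat)"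
      by simp
    ultimately have "k = 2 \<and> k dvd 3"
      using k_ge_2 k_neq_3 by auto
    then show False
      by auto
  qed

  \<comment> \<open>Players and their weights\<close>
  define t where "t = weight w UNIV"
  have weight_le: "0 \<le> weight w A" "weight w A \<le> t" for A
    using w_pos[THEN less_imp_le] unfolding t_def weight_def by (auto intro!: sum_nonneg sum_mono2)
  then have t: "0 \<le> t"
    by (simp add: t_def)
  \<comment> \<open>Every heavy player weighs at least \<open>t + 1\<close>. So the old players
    alone stay below \<open>q\<close>, and two heavy players reach at least
    \<open>2 * t + 2\<close>, which exceeds \<open>q\<close>.\<close>
  define q where "q = 2 * t + 1"
  define P :: "('n + nat) set" where "P = range Inl \<union> Inr ` {1..k}"
  define f :: "'n + nat \<Rightarrow> real" where
    "f = case_sum (\<lambda>a. w $ a) (\<lambda>i. q - weight w (X i))"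
  define T U where "T i = insert (Inr i) (Inl ` X i)" and "U i = insert (Inr i) (Inl ` Y i)"
    for i :: nat
  have f_Inr: "t < f (Inr i)" for i
    using weight_le(2)[of "X i"] t by (simp add: f_def q_def)
  have sum_Inl: "sum f (Inl ` A) = weight w A" for A
    by (subst sum.reindex) (simp_all add: f_def weight_def)
  have finP: "finite P"
    by (simp add: P_def)
  have cardP: "card P = CARD('n) + k"
  proof -
    have "card P = card (range Inl :: ('n + nat) set) + card (Inr ` {1..k} :: ('n + nat) set)"
      unfolding P_def by (intro card_Un_disjoint) auto
    then show ?thesis
      by (simp add: card_image)
  qed
  have insert_sum: "sum f (insert (Inr i) (Inl ` A)) = q - weight w (X i) + weight w A" for i A
  proof -
    have "f (Inr i) = q - weight w (X i)"
      by (simp add: f_def)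
    then show ?thesis
      by (subst sum.insert) (auto simp: sum_Inl)
  qed

  \<comment> \<open>The trading transform from \<open>T\<close> to \<open>U\<close>\<close>
  have mem: "Inl x \<in> T i \<longleftrightarrow> x \<in> X i" "Inl x \<in> U i \<longleftrightarrow> x \<in> Y i"
    "Inr l \<in> T i \<longleftrightarrow> i = l" "Inr l \<in> U i \<longleftrightarrow> i = l" for x i l
    by (auto simp: T_def U_def)
  have tt: "trading_transform P k T U"
    unfolding trading_transform_def
  proof (intro conjI ballI)
    fix p assume "p \<in> P"
    show "card {i \<in> {1..k}. p \<in> T i} = card {i \<in> {1..k}. p \<in> U i}"
    proof (cases p)
      case (Inl a)
      \<comment> \<open>Coordinate \<open>a\<close> of \<open>sum0\<close> states that the old
        player \<open>a\<close> is balanced.\<close>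
      have "0 = (\<Sum>i=1..k. diff_vec (X i) (Y i)) $ a"
        unfolding sum0 by simp
      also have "\<dots> = (\<Sum>i=1..k. if a \<in> X i then 1 else 0) - (\<Sum>i=1..k. if a \<in> Y i then 1 else 0)"
        by (simp add: diff_vec_def char_vec_def sum_subtractf)
      also have "\<dots> = real (card {i\<in>{1..k}. a \<in> X i}) - real (card {i\<in>{1..k}. a \<in> Y i})"
        by (simp add: sum.inter_filter [symmetric])
      finally show ?thesis
        by (simp add: Inl mem)
    next
      case (Inr i)
      then show ?thesis
        by (simp add: mem)
    qed
  qed (auto simp: P_def T_def U_def)

  \<comment> \<open>Coalitions of weight exactly \<open>q\<close>\<close>
  have ties: "S \<in> T ` {1..k} \<or> S \<in> U ` {1..k}" if S: "S \<subseteq> P" "sum f S = q" for S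
  proof -
    define A where "A = Inl -` S"
    define Z where "Z = Inr -` S"
    have S_eq: "S = Inl ` A \<union> Inr ` Z"
    proof (intro set_eqI iffI)
      fix x assume "x \<in> S"
      then show "x \<in> Inl ` A \<union> Inr ` Z"
        by (cases x) (auto simp: A_def Z_def)
    qed (auto simp: A_def Z_def)
    have Z: "Z \<subseteq> {1..k}"
      using S(1) by (auto simp: Z_def P_def)
    then have finZ: "finite Z"
      by (rule finite_subset) simp
    have sum_S: "q = weight w A + (\<Sum>i\<in>Z. f (Inr i))"
      unfolding S(2)[symmetric] S_eq using finZ
      by (subst sum.union_disjoint) (auto simp: sum_Inl sum.reindex)
    have "\<exists>i. Z = {i}"
    proof (rule ccontr)
      assume no: "\<nexists>i. Z = {i}"
      show False
      proof (cases "Z = {}")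
        case True
        then show False
          using sum_S weight_le(2)[of A] t by (simp add: q_def)
      next
        case False
        then obtain i where i: "i \<in> Z"
          by blast
        then obtain j where j: "j \<in> Z" "j \<noteq> i"
          using no by blast
        have "f (Inr i) + f (Inr j) = (\<Sum>i\<in>{i, j}. f (Inr i))"
          using j by simp
        also have "\<dots> \<le> (\<Sum>i\<in>Z. f (Inr i))"
          using finZ i j f_Inr t by (intro sum_mono2) (auto intro: order.trans less_imp_le)
        finally have "f (Inr i) + f (Inr j) \<le> q"
          using sum_S weight_le(1)[of A] by simp
        then show False
          using weight_le(2)[of "X i"] weight_le(2)[of "X j"] by (simp add: f_def q_def)
      qed
    qed
    then obtain i where i: "Z = {i}"
      by blast
    then have "S = insert (Inr i) (Inl ` A)" and "i \<in> {1..k}"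
      using S_eq Z by auto
    \<comment> \<open>Cancelling the heavy player \<open>i\<close> leaves
      \<open>weight w A = weight w (X i)\<close>.\<close>
    moreover from this have "A = X i \<or> A = Y i"
      using tie[of i A] S(2) by (simp add: insert_sum)
    ultimately show ?thesis
      by (auto simp: T_def U_def)
  qed

  \<comment> \<open>Trading transforms with fewer than \<open>k\<close> coalitions\<close>
  have short: False
    if j: "1 \<le> j" "j < k" and tr: "trading_transform P j C D"
      and C: "C ` {1..j} \<subseteq> T ` {1..k}" and D: "D ` {1..j} \<subseteq> U ` {1..k}" for j C D
  proof -
    have "\<forall>a\<in>{1..j}. \<exists>i\<in>{1..k}. C a = T i"
      using C by blast
    then obtain r where r: "\<And>a. a \<in> {1..j} \<Longrightarrow> r a \<in> {1..k} \<and> C a = T (r a)"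
      by metis
    have "\<forall>a\<in>{1..j}. \<exists>i\<in>{1..k}. D a = U i"
      using D by blast
    then obtain s where s: "\<And>a. a \<in> {1..j} \<Longrightarrow> s a \<in> {1..k} \<and> D a = U (s a)"
      by metis
    have bal: "card {a\<in>{1..j}. p \<in> T (r a)} = card {a\<in>{1..j}. p \<in> U (s a)}" if "p \<in> P" for p
    proof -
      have "{a\<in>{1..j}. p \<in> T (r a)} = {a\<in>{1..j}. p \<in> C a}"
        "{a\<in>{1..j}. p \<in> U (s a)} = {a\<in>{1..j}. p \<in> D a}"
        using r s by auto
      then show ?thesis
        using tr that by (simp add: trading_transform_def)
    qed
    define c where "c i = card {a\<in>{1..j}. r a = i}" for i
    \<comment> \<open>Of all the tied coalitions only \<open>T i\<close> and \<open>U i\<close>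
      contain the heavy player \<open>i\<close>, so balance at this player equates their
      multiplicities.\<close>
    have c_s: "c i = card {a\<in>{1..j}. s a = i}" if "i \<in> {1..k}" for i
      using bal[of "Inr i"] that by (simp add: c_def mem P_def)
    have group: "(\<Sum>a=1..j. g (r a)) = (\<Sum>i=1..k. real (c i) * g i)"
        "(\<Sum>a=1..j. g (s a)) = (\<Sum>i=1..k. real (c i) * g i)" for g :: "nat \<Rightarrow> real"
    proof -
      have "(\<Sum>a=1..j. g (r a)) = (\<Sum>i=1..k. \<Sum>a\<in>{a\<in>{1..j}. r a = i}. g (r a))"
        using r by (intro sum.group [symmetric]) auto
      then show "(\<Sum>a=1..j. g (r a)) = (\<Sum>i=1..k. real (c i) * g i)"
        by (simp add: c_def)
      have "(\<Sum>a=1..j. g (s a)) = (\<Sum>i=1..k. \<Sum>a\<in>{a\<in>{1..j}. s a = i}. g (s a))"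
        using s by (intro sum.group [symmetric]) auto
      then show "(\<Sum>a=1..j. g (s a)) = (\<Sum>i=1..k. real (c i) * g i)"
        by (simp add: c_s)
    qed
    \<comment> \<open>Balance at the old players makes the multiplicities the coefficients of a
      linear dependence.\<close>
    have "(\<Sum>i=1..k. real (c i) *\<^sub>R v i) $ x = 0" for x
    proof -
      have "(\<Sum>a=1..j. if x \<in> X (r a) then 1 else 0) = (\<Sum>a=1..j. if x \<in> Y (s a) then 1 else (0::real))"
        using bal[of "Inl x"]
        by (simp add: sum.inter_filter [symmetric] mem P_def)
      then have "(\<Sum>i=1..k. real (c i) * (if x \<in> X i then 1 else 0))
          = (\<Sum>i=1..k. real (c i) * (if x \<in> Y i then 1 else 0))"
        using group(1)[of "\<lambda>i. if x \<in> X i then 1 else 0"]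
          group(2)[of "\<lambda>i. if x \<in> Y i then 1 else 0"] by simp
      then show ?thesis
        by (simp add: v_def diff_vec_def char_vec_def right_diff_distrib sum_subtractf)
    qed
    then have "(\<Sum>i=1..k. real (c i) *\<^sub>R v i) = 0"
      by (simp add: vec_eq_iff)
    then have c1: "c i = c 1" if "i \<in> {1..k}" for i
      using coeff_eq[of "\<lambda>i. real (c i)" i] that by simp
    \<comment> \<open>All \<open>k\<close> multiplicities agree, so their total \<open>j\<close> is
      a multiple of \<open>k\<close>, which \<open>1 \<le> j < k\<close> excludes.\<close>
    have "real j = (\<Sum>i=1..k. real (c i))"
      using group(1)[of "\<lambda>_. 1"] by simp
    also have "\<dots> = (\<Sum>i=1..k. real (c 1))"
      using c1 by (intro sum.cong refl) (simp only:)
    also have "\<dots> = real (k * c 1)"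
      by simp
    finally have "j = k * c 1"
      using of_nat_eq_iff by blast
    then show False
      using j by (cases "c 1") auto
  qed

  have "0 < f p" if "p \<in> P" for p
  proof (cases p)
    case (Inl a)
    then show ?thesis
      using w_pos by (simp add: f_def)
  next
    case (Inr i)
    then show ?thesis
      using f_Inr[of i] t by simp
  qed
  moreover have "sum f (T i) = q" "sum f (U i) = q" if "i \<in> {1..k}" for i
    using eq[OF that] by (simp_all add: T_def U_def insert_sum)
  moreover have "0 < q"
    using t by (simp add: q_def)
  ultimately have "\<exists>W. simple_game P W \<and> trade_robust (k - 1) P W \<and> \<not> trade_robust k P W"
    using finP k_ge_2 ties tt short by (intro tie_breaking_game[of P f q k T U])
  then show ?thesis
    using cardP by blast
qed

section \<open>A semimagic square\<close>

text \<open>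
  Player \<open>3 * r + c\<close> is the cell in row \<open>r\<close> and column \<open>c\<close>.  The weights were found by computer
  search: rows and columns are the only sets of weight 31.
\<close>

definition square_weight :: "nat \<Rightarrow> nat" where
  "square_weight p = [2, 10, 19, 14, 8, 9, 15, 13, 3] ! p"

definition square_row :: "nat \<Rightarrow> nat set" where
  "square_row r = {3 * r, 3 * r + 1, 3 * r + 2}"

definition square_col :: "nat \<Rightarrow> nat set" where
  "square_col c = {c, c + 3, c + 6}"

text \<open>The Booleans encode membership of the players 0 to 8, so the case split checks all 512
  coalitions. The sum is bracketed as in \<open>square_ties\<close>.\<close>

lemma square_indicators:
  assumes "2 * of_bool a + (10 * of_bool b + (19 * of_bool c +
    (14 * of_bool d + (8 * of_bool e + (9 * of_bool f +
    (15 * of_bool g + (13 * of_bool h + 3 * of_bool i))))))) = (31 :: nat)"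
  shows "(if a then {0} else {}) \<union> (if b then {1} else {}) \<union> (if c then {2} else {}) \<union>
      (if d then {3} else {}) \<union> (if e then {4} else {}) \<union> (if f then {5} else {}) \<union>
      (if g then {6} else {}) \<union> (if h then {7} else {}) \<union> (if i then {8} else {})
    \<in> {{0, 1, 2}, {3, 4, 5}, {6, 7, 8}, {0, 3, 6}, {1, 4, 7}, {2, 5, 8 :: nat}}"
  using assms by (cases a; cases b; cases c; cases d; cases e; cases f; cases g; cases h; cases i; simp add: insert_commute)

lemma lessThan_9: "{..<9::nat} = {0, 1, 2, 3, 4, 5, 6, 7, 8}"
  by auto

lemma square_ties:
  assumes S: "S \<subseteq> {..<9}" and sum: "sum square_weight S = 31"
  shows "S \<in> square_row ` {0, 1, 2} \<or> S \<in> square_col ` {0, 1, 2}"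
proof -
  have weights: "square_weight 0 = 2" "square_weight 1 = 10" "square_weight 2 = 19"
    "square_weight 3 = 14" "square_weight 4 = 8" "square_weight 5 = 9"
    "square_weight 6 = 15" "square_weight 7 = 13" "square_weight 8 = 3"
    by (simp_all add: square_weight_def)
  have "31 = (\<Sum>p\<in>{..<9}. if p \<in> S then square_weight p else 0)"
    unfolding sum [symmetric] sum.inter_restrict [OF finite_lessThan, symmetric]
    using S by (simp only: inf_absorb2)
  also have "\<dots> = (\<Sum>p\<in>{..<9}. square_weight p * of_bool (p \<in> S))"
    by (intro sum.cong refl) simp
  also have "\<dots> = 2 * of_bool (0 \<in> S) + (10 * of_bool (1 \<in> S) + (19 * of_bool (2 \<in> S) +
      (14 * of_bool (3 \<in> S) + (8 * of_bool (4 \<in> S) + (9 * of_bool (5 \<in> S) +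
      (15 * of_bool (6 \<in> S) + (13 * of_bool (7 \<in> S) + 3 * of_bool (8 \<in> S))))))))"
    (is "_ = ?s")
    unfolding lessThan_9 by (simp add: weights [simplified])
  finally have "?s = 31"
    by (rule sym)
  note ind = square_indicators [OF this]
  have singleton: "(if n \<in> S then {n} else {}) = S \<inter> {n}" for n
    by simp
  have indicators: "(if 0 \<in> S then {0} else {}) \<union> (if 1 \<in> S then {1} else {}) \<union> (if 2 \<in> S then {2} else {}) \<union>
      (if 3 \<in> S then {3} else {}) \<union> (if 4 \<in> S then {4} else {}) \<union> (if 5 \<in> S then {5} else {}) \<union>
      (if 6 \<in> S then {6} else {}) \<union> (if 7 \<in> S then {7} else {}) \<union> (if 8 \<in> S then {8} else {}) = S"
    using S unfolding lessThan_9 singleton by blast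
  have "S \<in> {{0, 1, 2}, {3, 4, 5}, {6, 7, 8}, {0, 3, 6}, {1, 4, 7}, {2, 5, 8}}"
    using ind unfolding indicators .
  moreover have images: "square_row ` {0, 1, 2} = {{0, 1, 2}, {3, 4, 5}, {6, 7, 8}}"
    "square_col ` {0, 1, 2} = {{0, 3, 6}, {1, 4, 7}, {2, 5, 8}}"
    by (simp_all add: square_row_def square_col_def numeral_2_eq_2)
  ultimately show ?thesis
    unfolding images by (simp only: insert_iff empty_iff disj_assoc simp_thms)
qed

lemma mem_square_row: "p \<in> square_row r \<longleftrightarrow> p div 3 = r"
  unfolding square_row_def by auto

lemma mem_square_col: "c < 3 \<Longrightarrow> p < 9 \<Longrightarrow> p \<in> square_col c \<longleftrightarrow> p mod 3 = c"
  unfolding square_col_def insert_iff empty_iff by presburger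

lemma square_game:
  "\<exists>W. simple_game {..<9::nat} W \<and> trade_robust 2 {..<9} W \<and> \<not> trade_robust 3 {..<9} W"
proof -
  \<comment> \<open>The families are indexed from 1, rows and columns from 0.\<close>
  define T U where "T i = square_row (i - 1)" and "U i = square_col (i - 1)" for i
  have three: "{1..3::nat} = {1, 2, 3}"
    by auto
  have T_image: "T ` {1..3} = square_row ` {0, 1, 2}" and U_image: "U ` {1..3} = square_col ` {0, 1, 2}"
    unfolding three by (simp_all add: T_def U_def)
  have weight: "sum square_weight (T i) = 31" "sum square_weight (U i) = 31" if "i \<in> {1..3}" for i
    using that unfolding three
    by (auto simp: T_def U_def square_row_def square_col_def square_weight_def)
  have pos: "0 < square_weight p" if "p \<in> {..<9}" for p
    using that unfolding lessThan_9 by (auto simp: square_weight_def)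
  \<comment> \<open>Each cell lies in exactly one row and one column, so trading all rows for all
    columns is balanced.\<close>
  have single: "{i \<in> {1..3}. p \<in> T i} = {p div 3 + 1}" "{i \<in> {1..3}. p \<in> U i} = {p mod 3 + 1}"
    if "p < 9" for p
    using that by (auto simp: T_def U_def mem_square_row mem_square_col)
  have sub: "T i \<subseteq> {..<9}" "U i \<subseteq> {..<9}" if "i \<in> {1..3}" for i
    using that by (auto simp: T_def U_def square_row_def square_col_def)
  have trade: "trading_transform {..<9} 3 T U"
    unfolding trading_transform_def
  proof (intro conjI ballI)
    fix p :: nat assume "p \<in> {..<9}"
    then have "p < 9"
      by simp
    then show "card {i \<in> {1..3}. p \<in> T i} = card {i \<in> {1..3}. p \<in> U i}"
      unfolding single [OF \<open>p < 9\<close>] by simp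
  qed (use sub in blast)+
  text \<open>Some column differs from both \<open>Y\<^sub>1\<close> and \<open>Y\<^sub>2\<close>; its cell in the row \<open>X\<^sub>1\<close> is not traded.\<close>
  have short: False
    if j: "1 \<le> j" "j < 3" and tr: "trading_transform {..<9} j X Y"
      and X: "X ` {1..j} \<subseteq> T ` {1..3}" and Y: "Y ` {1..j} \<subseteq> U ` {1..3}" for j X Y
  proof -
    have "1 \<in> {1..j}"
      using j by simp
    then obtain r where r: "r \<in> {0, 1, 2}" "X 1 = square_row r"
      using X unfolding T_image by blast
    have "\<forall>i\<in>{1..j}. \<exists>c\<in>{0, 1, 2}. Y i = square_col c"
      using Y unfolding U_image by blast
    then obtain s where s: "\<And>i. i \<in> {1..j} \<Longrightarrow> s i \<in> {0, 1, 2} \<and> Y i = square_col (s i)"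
      by metis
    have "card (s ` {1..j}) \<le> j"
      using card_image_le[of "{1..j}" s] by simp
    then have "\<not> {0, 1, 2} \<subseteq> s ` {1..j}"
      using card_mono[of "s ` {1..j}" "{0, 1, 2}"] j by auto
    then obtain c where c: "c \<in> {0, 1, 2}" "c \<notin> s ` {1..j}"
      by blast
    define p where "p = 3 * r + c"
    have "p \<in> X 1"
      using r c(1) by (auto simp: p_def square_row_def)
    moreover have "p \<notin> Y i" if "i \<in> {1..j}" for i
    proof -
      have "s i \<noteq> c"
        using c(2) that by blast
      then show ?thesis
        using s[OF that] r(1) c(1) by (auto simp: p_def square_col_def)
    qed
    ultimately have in_X: "1 \<in> {i\<in>{1..j}. p \<in> X i}" and Y_empty: "{i\<in>{1..j}. p \<in> Y i} = {}"
      using j by auto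
    have "p \<in> {..<9}"
      using r(1) c(1) by (auto simp: p_def)
    then have "card {i\<in>{1..j}. p \<in> X i} = card {i\<in>{1..j}. p \<in> Y i}"
      using tr unfolding trading_transform_def by blast
    then have "card {i\<in>{1..j}. p \<in> X i} = 0"
      unfolding Y_empty by simp
    then have "{i\<in>{1..j}. p \<in> X i} = {}"
      by (subst (asm) card_eq_0_iff) auto
    with in_X show False
      by blast
  qed
  have sum_real: "(\<Sum>p\<in>S. real (square_weight p)) = 31 \<longleftrightarrow> sum square_weight S = 31" for S
    by (simp flip: of_nat_sum)
  have "\<exists>W. simple_game {..<9::nat} W \<and> trade_robust (3 - 1) {..<9} W \<and> \<not> trade_robust 3 {..<9} W"
  proof (rule tie_breaking_game[where f = "\<lambda>p. real (square_weight p)" and q = 31 and T = T and U = U])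
    show "S \<in> T ` {1..3} \<or> S \<in> U ` {1..3}"
      if "S \<subseteq> {..<9}" "(\<Sum>p\<in>S. real (square_weight p)) = 31" for S
      using square_ties[of S] that unfolding sum_real T_image U_image by blast
    show "(\<Sum>p\<in>T i. real (square_weight p)) = 31" "(\<Sum>p\<in>U i. real (square_weight p)) = 31"
      if "i \<in> {1..3}" for i
      unfolding sum_real using weight [OF that] .
    show "0 < real (square_weight p)" if "p \<in> {..<9}" for p
      using pos [OF that] by simp
    show False
      if "1 \<le> j" "j < 3" "trading_transform {..<9} j X Y"
        "X ` {1..j} \<subseteq> T ` {1..3}" "Y ` {1..j} \<subseteq> U ` {1..3}" for j X Y
      using that by (rule short)
  qed (fact trade | simp)+
  then show ?thesis
    by simp
qed

theorem theorem5:
  fixes w :: "real ^ 'n::finite" and k :: nat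
  assumes n_gt_2: "2 < CARD('n)"
    and w_pos: "\<And>i. 0 < w $ i"
    and fishburn: "fishburn_condition k w"
    and k_ge_2: "2 \<le> k"
    and k_eq_3: "k = 3 \<Longrightarrow> 6 \<le> CARD('n)"
  shows "\<exists>(P :: nat set) W.
           simple_game P W \<and> card P = CARD('n) + k \<and>
           trade_robust (k - 1) P W \<and> \<not> trade_robust k P W"
proof (cases "k = 3")
  case True
  obtain W where "simple_game {..<9::nat} W" "trade_robust 2 {..<9} W" "\<not> trade_robust 3 {..<9} W"
    using square_game by blast
  \<comment> \<open>The nine cells fit into \<open>CARD('n) + 3\<close> players as
    \<open>CARD('n)\<close> is at least 6; dummies fill the remaining places.\<close>
  then show ?thesis
    using game_on_nat[of "{..<9::nat}" W 2 3 "CARD('n) + k"] k_eq_3 True by simp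
next
  case False
  obtain P :: "('n + nat) set" and W where "simple_game P W" "card P = CARD('n) + k"
    "trade_robust (k - 1) P W" "\<not> trade_robust k P W"
    using fishburn_game[OF w_pos fishburn k_ge_2 False] by blast
  then show ?thesis
    using game_on_nat[of P W "k - 1" k "CARD('n) + k"] by simp
qed

end
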